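(* Let $(A, X_1, X_2, X_3)$ be an $\mathbb{H}$-contraction on a complex Hilbert space. Then: (1) $(A, X_1)$ and $(A, X_2)$ are $\mathbb{B}_2$-contractions; (2) $(X_1, X_2, X_3)$ is an $\mathbb{E}$-contraction; (3) $(A, X_1+X_2, X_3)$ is a $\mathbb{P}$-contraction.
   Context: All operators are bounded linear maps on complex Hilbert spaces; $\mathbb{D}$ is the open unit disc in $\mathbb{C}$. $\mathbb{B}_2$ is the open Euclidean unit ball of $\mathbb{C}^2$. The tetrablock is $\mathbb{E}=\{(x_1,x_2,x_3)\in\mathbb{C}^3 : 1-x_1z_1-x_2z_2+x_3z_1z_2\neq 0 \text{ whenever } |z_1|\le 1, |z_2|\le 1\}$. The hexablock is $\mathbb{H}=\{(a,x_1,x_2,x_3)\in\mathbb{C}\times\mathbb{E} : \sup_{z_1,z_2\in\mathbb{D}}\left|\frac{a\sqrt{(1-|z_1|^2)(1-|z_2|^2)}}{1-x_1z_1-x_2z_2+x_3z_1z_2}\right|<1\}$. The symmetrized bidisc is $\mathbb{G}_2=\{(z_1+z_2,z_1z_2): |z_1|,|z_2|<1\}$ and the pentablock is $\mathbb{P}=\{(a,s,p)\in\mathbb{C}\times\mathbb{G}_2 : \sup_{z\in\mathbb{D}}\left|\frac{a(1-|z|^2)}{1-sz+pz^2}\right|<1\}$. The closures of these domains are polynomially convex. For a bounded domain $\Omega\subset\mathbb{C}^n$ with polynomially convex closure, a commuting $n$-tuple $\underline{T}$ of operators is an $\Omega$-contraction if $\overline{\Omega}$ is a spectral set for $\underline{T}$,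 i.e. $\|p(\underline{T})\|\le\sup_{\overline{\Omega}}|p|$ for every $p\in\mathbb{C}[z_1,\dots,z_n]$. *)

theory Defs
  imports "HOL-Analysis.Analysis" "HOL-Library.Poly_Mapping"
begin

(* Complex Hilbert spaces.  The inner product is linear in its first argument. *)

class chilbert_space = banach +
  fixes scaleC :: "complex \<Rightarrow> 'a \<Rightarrow> 'a" (infixr "*\<^sub>C" 75)
    and cinner :: "'a \<Rightarrow> 'a \<Rightarrow> complex"
  assumes scaleC_add_right: "c *\<^sub>C (x + y) = c *\<^sub>C x + c *\<^sub>C y"
    and scaleC_add_left: "(c + d) *\<^sub>C x = c *\<^sub>C x + d *\<^sub>C x"
    and scaleC_scaleC: "c *\<^sub>C d *\<^sub>C x = (c * d) *\<^sub>C x"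
    and scaleC_of_real: "complex_of_real r *\<^sub>C x = r *\<^sub>R x"
    and cinner_commute: "cinner x y = cnj (cinner y x)"
    and cinner_add_left: "cinner (x + y) z = cinner x z + cinner y z"
    and cinner_scaleC_left: "cinner (c *\<^sub>C x) y = c * cinner x y"
    and cinner_self: "cinner x x = complex_of_real ((norm x)\<^sup>2)"

instantiation complex :: chilbert_space
begin

definition "scaleC_complex (c :: complex) (x :: complex) = c * x"

definition "cinner_complex (x :: complex) (y :: complex) = x * cnj y"

instance
  by standard
    (simp_all add: scaleC_complex_def cinner_complex_def algebra_simps scaleR_conv_of_real
       complex_norm_square del: of_real_power)

end

(* Elements of the library type of bounded operators are only real-linear. *)

definition complex_linear_op :: "('a::chilbert_space \<Rightarrow>\<^sub>L 'a) \<Rightarrow> bool" where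
  "complex_linear_op T \<longleftrightarrow> (\<forall>c x. T (c *\<^sub>C x) = c *\<^sub>C T x)"

definition commuting_tuple :: "(('a::chilbert_space \<Rightarrow>\<^sub>L 'a) ^ 'n) \<Rightarrow> bool" where
  "commuting_tuple T \<longleftrightarrow>
     (\<forall>i. complex_linear_op (T $ i)) \<and> (\<forall>i j. T $ i o\<^sub>L T $ j = T $ j o\<^sub>L T $ i)"

(* The ring of complex polynomials in variables indexed by 'n: finitely supported families of
   coefficients, indexed by exponent vectors. *)

type_synonym 'n cpoly = "(nat ^ 'n) \<Rightarrow>\<^sub>0 complex"

definition poly_at :: "'n::finite cpoly \<Rightarrow> complex ^ 'n \<Rightarrow> complex" where
  "poly_at p z = (\<Sum>m\<in>Poly_Mapping.keys p. Poly_Mapping.lookup p m * (\<Prod>i\<in>UNIV. (z $ i) ^ (m $ i)))"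

(* The product of the powers (T $ i) ^ (m $ i).  For a commuting tuple the fold does not depend
   on the order of the indices. *)

definition monom_op :: "(('a::chilbert_space \<Rightarrow>\<^sub>L 'a) ^ 'n::finite) \<Rightarrow> nat ^ 'n \<Rightarrow> 'a \<Rightarrow> 'a" where
  "monom_op T m = Finite_Set.fold (\<lambda>i S. (blinfun_apply (T $ i) ^^ (m $ i)) \<circ> S) id UNIV"

definition poly_op :: "'n::finite cpoly \<Rightarrow> (('a::chilbert_space \<Rightarrow>\<^sub>L 'a) ^ 'n) \<Rightarrow> 'a \<Rightarrow> 'a" where
  "poly_op p T = (\<lambda>x. \<Sum>m\<in>Poly_Mapping.keys p. Poly_Mapping.lookup p m *\<^sub>C monom_op T m x)"

(* Intended for nonempty compact K, where the supremum is finite. *)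

definition spectral_set :: "(complex ^ 'n::finite) set \<Rightarrow> (('a::chilbert_space \<Rightarrow>\<^sub>L 'a) ^ 'n) \<Rightarrow> bool" where
  "spectral_set K T \<longleftrightarrow> (\<forall>p. onorm (poly_op p T) \<le> (SUP z\<in>K. cmod (poly_at p z)))"

(* Intended for nonempty bounded domains with polynomially convex closure. *)

definition domain_contraction ::
    "(complex ^ 'n::finite) set \<Rightarrow> (('a::chilbert_space \<Rightarrow>\<^sub>L 'a) ^ 'n) \<Rightarrow> bool" where
  "domain_contraction \<Omega> T \<longleftrightarrow> commuting_tuple T \<and> spectral_set (closure \<Omega>) T"

abbreviation unit_disc :: "complex set" where
  "unit_disc \<equiv> ball 0 1"

(* The norm on complex ^ 2 is the Euclidean one. *)

definition euclidean_ball2 :: "(complex ^ 2) set" where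
  "euclidean_ball2 = ball 0 1"

definition tetrablock :: "(complex ^ 3) set" where
  "tetrablock = {vector [x1, x2, x3] | x1 x2 x3.
     \<forall>z1 z2. cmod z1 \<le> 1 \<and> cmod z2 \<le> 1 \<longrightarrow> 1 - x1 * z1 - x2 * z2 + x3 * z1 * z2 \<noteq> 0}"

(* In the next and the last definition membership of the remaining coordinates in the tetrablock
   (symmetrized bidisc) keeps the denominator away from 0, so the supremum is over a bounded set. *)

definition hexablock :: "(complex ^ 4) set" where
  "hexablock = {vector [a, x1, x2, x3] | a x1 x2 x3.
     vector [x1, x2, x3] \<in> tetrablock \<and>
     (SUP (z1, z2)\<in>unit_disc \<times> unit_disc.
        cmod (a * complex_of_real (sqrt ((1 - (cmod z1)\<^sup>2) * (1 - (cmod z2)\<^sup>2)))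
              / (1 - x1 * z1 - x2 * z2 + x3 * z1 * z2))) < 1}"

definition symmetrized_bidisc :: "(complex ^ 2) set" where
  "symmetrized_bidisc = {vector [z1 + z2, z1 * z2] | z1 z2. cmod z1 < 1 \<and> cmod z2 < 1}"

definition pentablock :: "(complex ^ 3) set" where
  "pentablock = {vector [a, s, p] | a s p.
     vector [s, p] \<in> symmetrized_bidisc \<and>
     (SUP z\<in>unit_disc.
        cmod (a * complex_of_real (1 - (cmod z)\<^sup>2) / (1 - s * z + p * z\<^sup>2))) < 1}"

end

theory Submission
  imports Defs
begin

text \<open>
  All four assertions are instances of one principle: the spectral set property is transported by
  polynomial maps. Let \<open>T\<close> be an \<open>\<Omega>\<close>-contraction, let \<open>\<phi>\<close> be a polynomial map with
  \<open>\<phi> ` \<Omega> \<subseteq> \<Omega>'\<close>, and let \<open>S = \<phi>(T)\<close>. For every polynomial \<open>p\<close> the composition \<open>p \<circ> \<phi>\<close> is again a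
  polynomial, and \<open>(p \<circ> \<phi>)(T) = p(S)\<close>. Hence
  \<open>\<parallel>p(S)\<parallel> \<le> sup {\<bar>p (\<phi> z)\<bar> | z \<in> closure \<Omega>} \<le> sup {\<bar>p w\<bar> | w \<in> closure \<Omega>'}\<close>,
  because \<open>\<phi>\<close> is continuous and so maps \<open>closure \<Omega>\<close> into \<open>closure \<Omega>'\<close>. This is
  \<open>domain_contraction_image\<close>.

  The maps needed here are \<open>(a, x1, x2, x3) \<mapsto> (a, x1)\<close>, \<open>(a, x2)\<close>, \<open>(x1, x2, x3)\<close> and
  \<open>(a, x1 + x2, x3)\<close>, so it remains to see that they send the hexablock into the ball, the tetrablock
  and the pentablock. Each inclusion comes from restricting the supremum that defines the hexablock.
  At \<open>z1 = cnj x1\<close>, \<open>z2 = 0\<close> the functional equals \<open>\<bar>a\<bar> / sqrt (1 - \<bar>x1\<bar>\<^sup>2)\<close>, which gives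
  \<open>\<bar>a\<bar>\<^sup>2 + \<bar>x1\<bar>\<^sup>2 < 1\<close>; exchanging the roles of the variables treats \<open>x2\<close>
  (\<open>hexablock_to_ball\<close>). On the diagonal \<open>z1 = z2\<close> the functional of the hexablock is the functional
  of the pentablock with \<open>s = x1 + x2\<close> and \<open>p = x3\<close> (\<open>hexablock_to_pentablock\<close>). In the same way the
  tetrablock condition on the diagonal says that \<open>1 - s z + p z\<^sup>2\<close> has no zero in the closed disc,
  and this characterizes the points \<open>(s, p)\<close> of the symmetrized bidisc.
\<close>

section \<open>Complex scalars and monomials in a commuting tuple\<close>


lemma scaleC_zero_left: "0 *\<^sub>C (x::'a::chilbert_space) = 0"
  using scaleC_of_real[of 0 x] by simp

lemma scaleC_one: "1 *\<^sub>C (x::'a::chilbert_space) = x"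
  using scaleC_of_real[of 1 x] by simp

lemma scaleC_zero_right: "c *\<^sub>C (0::'a::chilbert_space) = 0"
  using scaleC_add_right[of c "0::'a" 0] by simp

lemma scaleC_sum_right:
  "c *\<^sub>C (\<Sum>i\<in>I. f i) = (\<Sum>i\<in>I. c *\<^sub>C (f i :: 'a::chilbert_space))"
  by (induction I rule: infinite_finite_induct) (simp_all add: scaleC_zero_right scaleC_add_right)

lemma funpow_comp_commute:
  assumes "f \<circ> g = g \<circ> f"
  shows "(f ^^ m) \<circ> (g ^^ n) = (g ^^ n) \<circ> (f ^^ m)"
proof -
  have *: "f \<circ> (h ^^ n) = (h ^^ n) \<circ> f" if "f \<circ> h = h \<circ> f" for f h :: "'a \<Rightarrow> 'a" and n
  proof (induction n)
    case (Suc n)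
    have "f \<circ> (h ^^ Suc n) = (f \<circ> h) \<circ> (h ^^ n)"
      by (simp only: funpow.simps(2) comp_assoc)
    also have "\<dots> = h \<circ> (f \<circ> (h ^^ n))"
      by (simp only: that comp_assoc)
    also have "\<dots> = (h ^^ Suc n) \<circ> f"
      by (simp only: Suc.IH funpow.simps(2) comp_assoc)
    finally show ?case .
  qed simp
  have "g \<circ> (f ^^ m) = (f ^^ m) \<circ> g"
    by (rule *) (rule assms[symmetric])
  from *[OF this[symmetric], of n] show ?thesis .
qed

text \<open>
  The same fold as in \<open>monom_op\<close>, but over an arbitrary index set \<open>I\<close>, so that statements about
  monomials can be proved by induction on \<open>I\<close>.
\<close>

definition partial_monom_op ::
    "'n set \<Rightarrow> (('a::chilbert_space \<Rightarrow>\<^sub>L 'a) ^ 'n::finite) \<Rightarrow> nat ^ 'n \<Rightarrow> 'a \<Rightarrow> 'a" where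
  "partial_monom_op I T m = Finite_Set.fold (\<lambda>i S. (blinfun_apply (T $ i) ^^ (m $ i)) \<circ> S) id I"

lemma monom_op_eq_partial: "monom_op T m = partial_monom_op UNIV T m"
  by (simp add: monom_op_def partial_monom_op_def)

lemma commuting_tuple_funpow:
  assumes "commuting_tuple T"
  shows "(blinfun_apply (T $ i) ^^ m) \<circ> (blinfun_apply (T $ j) ^^ n) =
         (blinfun_apply (T $ j) ^^ n) \<circ> (blinfun_apply (T $ i) ^^ m)"
proof (rule funpow_comp_commute)
  have "T $ i o\<^sub>L T $ j = T $ j o\<^sub>L T $ i"
    using assms by (simp add: commuting_tuple_def)
  then have "blinfun_apply (T $ i o\<^sub>L T $ j) x = blinfun_apply (T $ j o\<^sub>L T $ i) x" for x
    by (rule arg_cong)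
  then show "blinfun_apply (T $ i) \<circ> blinfun_apply (T $ j) = blinfun_apply (T $ j) \<circ> blinfun_apply (T $ i)"
    unfolding blinfun_apply_blinfun_compose comp_def by (rule ext)
qed

lemma partial_monom_op_empty: "partial_monom_op {} T m = id"
  by (simp add: partial_monom_op_def)

text \<open>
  The fold can be unfolded in any order of the indices exactly because the factors commute.
\<close>

lemma partial_monom_op_insert:
  assumes "commuting_tuple T" "i \<notin> I"
  shows "partial_monom_op (insert i I) T m =
         (blinfun_apply (T $ i) ^^ (m $ i)) \<circ> partial_monom_op I T m"
proof -
  interpret comp_fun_commute_on UNIV "\<lambda>i S. (blinfun_apply (T $ i) ^^ (m $ i)) \<circ> S"
  proof (unfold_locales, rule ext)
    fix i j S
    have c: "(blinfun_apply (T $ j) ^^ (m $ j)) \<circ> (blinfun_apply (T $ i) ^^ (m $ i)) =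
        (blinfun_apply (T $ i) ^^ (m $ i)) \<circ> (blinfun_apply (T $ j) ^^ (m $ j))"
      by (rule commuting_tuple_funpow[OF assms(1)])
    show "((\<lambda>S. (blinfun_apply (T $ j) ^^ (m $ j)) \<circ> S) \<circ> (\<lambda>S. (blinfun_apply (T $ i) ^^ (m $ i)) \<circ> S)) S =
        ((\<lambda>S. (blinfun_apply (T $ i) ^^ (m $ i)) \<circ> S) \<circ> (\<lambda>S. (blinfun_apply (T $ j) ^^ (m $ j)) \<circ> S)) S"
      by (simp only: comp_apply comp_assoc[symmetric] c)
  qed
  show ?thesis
    unfolding partial_monom_op_def by (rule fold_insert[OF subset_UNIV finite assms(2)])
qed

lemma partial_monom_op_commute:
  assumes "commuting_tuple T"
  shows "partial_monom_op I T m \<circ> (blinfun_apply (T $ i) ^^ n) =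
         (blinfun_apply (T $ i) ^^ n) \<circ> partial_monom_op I T m"
proof -
  have "finite I" by simp
  then show ?thesis
  proof induction
    case (insert j I)
    have "partial_monom_op (insert j I) T m \<circ> (blinfun_apply (T $ i) ^^ n) =
          (blinfun_apply (T $ j) ^^ (m $ j)) \<circ> ((blinfun_apply (T $ i) ^^ n) \<circ> partial_monom_op I T m)"
      by (simp only: partial_monom_op_insert[OF assms insert.hyps(2)] comp_assoc insert.IH)
    also have "\<dots> = (blinfun_apply (T $ i) ^^ n) \<circ> partial_monom_op (insert j I) T m"
      by (simp only: partial_monom_op_insert[OF assms insert.hyps(2)] comp_assoc[symmetric]
          commuting_tuple_funpow[OF assms, where i = j and j = i and m = "m $ j" and n = n])
    finally show ?case .
  qed (simp add: partial_monom_op_empty)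
qed

lemma monom_op_add:
  assumes "commuting_tuple T"
  shows "monom_op T (m + n) = monom_op T m \<circ> monom_op T n"
proof -
  have "partial_monom_op I T (m + n) = partial_monom_op I T m \<circ> partial_monom_op I T n" if "finite I" for I
    using that
  proof induction
    case (insert i I)
    have "partial_monom_op (insert i I) T (m + n) =
        (blinfun_apply (T $ i) ^^ (m $ i)) \<circ> ((blinfun_apply (T $ i) ^^ (n $ i)) \<circ> partial_monom_op I T m) \<circ>
        partial_monom_op I T n"
      by (simp only: partial_monom_op_insert[OF assms insert.hyps(2)] vector_add_component funpow_add
          comp_assoc insert.IH)
    also have "\<dots> = partial_monom_op (insert i I) T m \<circ> partial_monom_op (insert i I) T n"
      by (simp only: partial_monom_op_insert[OF assms insert.hyps(2)]
          partial_monom_op_commute[OF assms, where I = I and m = m and n = "n $ i", symmetric]) (simp only: comp_assoc)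
    finally show ?case .
  qed (simp add: partial_monom_op_empty)
  from this[of UNIV] show ?thesis by (simp add: monom_op_eq_partial)
qed

lemma partial_monom_op_trivial:
  assumes "commuting_tuple T" "\<And>i. i \<in> I \<Longrightarrow> m $ i = 0"
  shows "partial_monom_op I T m = id"
proof -
  have "finite I" by simp
  then show ?thesis
    using assms(2)
  proof induction
    case (insert i I)
    have "partial_monom_op I T m = id"
      by (rule insert.IH) (simp add: insert.prems)
    moreover have "m $ i = 0"
      by (rule insert.prems) simp
    ultimately show ?case
      by (simp only: partial_monom_op_insert[OF assms(1) insert.hyps(2)] funpow_0 funpow.simps(1) comp_id)
  qed (simp add: partial_monom_op_empty)
qed

lemma monom_op_axis:
  assumes "commuting_tuple T"
  shows "monom_op T (axis i 1) = blinfun_apply (T $ i)"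
proof -
  have *: "partial_monom_op (UNIV - {i}) T (axis i 1) = id"
    by (rule partial_monom_op_trivial[OF assms]) (simp add: axis_def)
  have "monom_op T (axis i 1) = partial_monom_op (insert i (UNIV - {i})) T (axis i 1)"
    by (simp add: monom_op_eq_partial)
  also have "\<dots> = blinfun_apply (T $ i)"
    by (subst partial_monom_op_insert[OF assms]) (simp_all add: *[unfolded One_nat_def])
  finally show ?thesis .
qed

text \<open>
  Operators of type \<open>_ \<Rightarrow>\<^sub>L _\<close> are only real-linear; homogeneity over the complex numbers comes from
  \<open>complex_linear_op\<close>, which is a part of \<open>commuting_tuple\<close>.
\<close>

lemma monom_op_linear:
  assumes "commuting_tuple T"
  shows "monom_op T m (c *\<^sub>C x) = c *\<^sub>C monom_op T m x"
    and "monom_op T m (x + y) = monom_op T m x + monom_op T m y"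
proof -
  have pow: "(blinfun_apply (T $ i) ^^ n) (c *\<^sub>C x) = c *\<^sub>C (blinfun_apply (T $ i) ^^ n) x" 
    "(blinfun_apply (T $ i) ^^ n) (x + y) = (blinfun_apply (T $ i) ^^ n) x + (blinfun_apply (T $ i) ^^ n) y"
    for i n c x y
    using assms by (induction n) (simp_all add: commuting_tuple_def complex_linear_op_def blinfun.add_right)
  have "partial_monom_op I T m (c *\<^sub>C x) = c *\<^sub>C partial_monom_op I T m x \<and>
        partial_monom_op I T m (x + y) = partial_monom_op I T m x + partial_monom_op I T m y"
    if "finite I" for I
    using that
    by induction (simp_all add: partial_monom_op_empty partial_monom_op_insert[OF assms] pow)
  from this[of UNIV] show "monom_op T m (c *\<^sub>C x) = c *\<^sub>C monom_op T m x"
    and "monom_op T m (x + y) = monom_op T m x + monom_op T m y"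
    by (simp_all add: monom_op_eq_partial)
qed

lemma monom_op_sum:
  assumes "commuting_tuple T"
  shows "monom_op T m (\<Sum>i\<in>I. f i) = (\<Sum>i\<in>I. monom_op T m (f i))"
proof -
  have "monom_op T m 0 = 0"
    using monom_op_linear(2)[OF assms, of m 0 0] by simp
  then show ?thesis
    by (induction I rule: infinite_finite_induct) (simp_all add: monom_op_linear(2)[OF assms])
qed

section \<open>The polynomial functional calculus\<close>

lemma poly_at_superset:
  assumes "finite K" "Poly_Mapping.keys p \<subseteq> K"
  shows "poly_at p z = (\<Sum>m\<in>K. Poly_Mapping.lookup p m * (\<Prod>i\<in>UNIV. (z $ i) ^ (m $ i)))"
  unfolding poly_at_def
  by (rule sum.mono_neutral_left) (use assms in \<open>auto simp: in_keys_iff\<close>)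

lemma poly_op_superset:
  assumes "finite K" "Poly_Mapping.keys p \<subseteq> K"
  shows "poly_op p T x = (\<Sum>m\<in>K. Poly_Mapping.lookup p m *\<^sub>C monom_op T m x)"
  unfolding poly_op_def
  by (rule sum.mono_neutral_left) (use assms in \<open>auto simp: in_keys_iff scaleC_zero_left\<close>)

text \<open>
  The graph of the functional calculus \<open>q \<mapsto> q(T)\<close>, viewed as a relation between functions and
  operators. Its closure properties below say that the calculus is an algebra homomorphism, and they
  allow one to compose polynomials without computing the coefficients of the composition.
\<close>

definition poly_calculus ::
    "(('a::chilbert_space \<Rightarrow>\<^sub>L 'a) ^ 'n::finite) \<Rightarrow> (complex ^ 'n \<Rightarrow> complex) \<Rightarrow> ('a \<Rightarrow> 'a) \<Rightarrow> bool" where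
  "poly_calculus T f F \<longleftrightarrow> (\<exists>q. poly_at q = f \<and> poly_op q T = F)"

lemma poly_calculus_monom:
  "poly_calculus T (\<lambda>z. c * (\<Prod>i\<in>UNIV. (z $ i) ^ (m $ i))) (\<lambda>x. c *\<^sub>C monom_op T m x)"
  unfolding poly_calculus_def
proof (intro exI conjI ext)
  fix z x
  show "poly_at (Poly_Mapping.single m c) z = c * (\<Prod>i\<in>UNIV. (z $ i) ^ (m $ i))"
    by (subst poly_at_superset[of "{m}"]) auto
  show "poly_op (Poly_Mapping.single m c) T x = c *\<^sub>C monom_op T m x"
    by (subst poly_op_superset[of "{m}"]) auto
qed

lemma poly_calculus_zero: "poly_calculus T (\<lambda>_. 0) (\<lambda>_. 0)"
  unfolding poly_calculus_def
  by (intro exI[of _ 0]) (simp add: fun_eq_iff poly_at_def poly_op_def)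

lemma poly_calculus_add:
  assumes "poly_calculus T f F" "poly_calculus T g G"
  shows "poly_calculus T (\<lambda>z. f z + g z) (\<lambda>x. F x + G x)"
proof -
  obtain p q where p: "poly_at p = f" "poly_op p T = F" and q: "poly_at q = g" "poly_op q T = G"
    using assms by (auto simp: poly_calculus_def)
  define K where "K = Poly_Mapping.keys p \<union> Poly_Mapping.keys q"
  have K: "finite K" "Poly_Mapping.keys p \<subseteq> K" "Poly_Mapping.keys q \<subseteq> K"
    "Poly_Mapping.keys (p + q) \<subseteq> K"
    using keys_add[of p q] by (auto simp: K_def)
  show ?thesis
    unfolding poly_calculus_def
  proof (intro exI conjI ext)
    fix z x
    show "poly_at (p + q) z = f z + g z"
      by (simp add: p[symmetric] q[symmetric] poly_at_superset[OF K(1,2)] poly_at_superset[OF K(1,3)]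
          poly_at_superset[OF K(1,4)] lookup_add distrib_right sum.distrib)
    show "poly_op (p + q) T x = F x + G x"
      by (simp add: p[symmetric] q[symmetric] poly_op_superset[OF K(1,2)] poly_op_superset[OF K(1,3)]
          poly_op_superset[OF K(1,4)] lookup_add scaleC_add_left sum.distrib)
  qed
qed

lemma poly_calculus_sum:
  assumes "\<And>i. i \<in> I \<Longrightarrow> poly_calculus T (f i) (F i)"
  shows "poly_calculus T (\<lambda>z. \<Sum>i\<in>I. f i z) (\<lambda>x. \<Sum>i\<in>I. F i x)"
  using assms
  by (induction I rule: infinite_finite_induct) (simp_all add: poly_calculus_zero poly_calculus_add)

text \<open>
  Multiplicativity. Expanding both polynomials into monomials and using \<open>monom_op_add\<close> presents the
  product as a finite sum of monomials \<open>m + n\<close>.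
\<close>

lemma poly_calculus_comp:
  assumes T: "commuting_tuple T" and f: "poly_calculus T f F" and g: "poly_calculus T g G"
  shows "poly_calculus T (\<lambda>z. f z * g z) (\<lambda>x. F (G x))"
proof -
  obtain p q where p: "poly_at p = f" "poly_op p T = F" and q: "poly_at q = g" "poly_op q T = G"
    using f g by (auto simp: poly_calculus_def)
  let ?c = "\<lambda>m n. Poly_Mapping.lookup p m * Poly_Mapping.lookup q n"
  have "poly_calculus T
      (\<lambda>z. \<Sum>m\<in>Poly_Mapping.keys p. \<Sum>n\<in>Poly_Mapping.keys q. ?c m n * (\<Prod>i\<in>UNIV. (z $ i) ^ ((m + n) $ i)))
      (\<lambda>x. \<Sum>m\<in>Poly_Mapping.keys p. \<Sum>n\<in>Poly_Mapping.keys q. ?c m n *\<^sub>C monom_op T (m + n) x)"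
    by (intro poly_calculus_sum poly_calculus_monom)
  moreover have "(\<Sum>m\<in>Poly_Mapping.keys p. \<Sum>n\<in>Poly_Mapping.keys q.
        ?c m n * (\<Prod>i\<in>UNIV. (z $ i) ^ ((m + n) $ i))) = f z * g z" for z
    by (simp add: p[symmetric] q[symmetric] poly_at_def sum_product power_add prod.distrib mult_ac)
  moreover have "(\<Sum>m\<in>Poly_Mapping.keys p. \<Sum>n\<in>Poly_Mapping.keys q.
        ?c m n *\<^sub>C monom_op T (m + n) x) = F (G x)" for x
    by (simp add: p[symmetric] q[symmetric] poly_op_def monom_op_add[OF T] monom_op_sum[OF T]
        monom_op_linear(1)[OF T] scaleC_sum_right scaleC_scaleC)
  ultimately show ?thesis by simp
qed

lemma poly_calculus_one:
  assumes "commuting_tuple T"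
  shows "poly_calculus T (\<lambda>_. 1) (\<lambda>x. x)"
  using poly_calculus_monom[of T 1 0] partial_monom_op_trivial[OF assms, of UNIV 0]
  by (simp add: monom_op_eq_partial scaleC_one id_def)

lemma poly_calculus_coord:
  assumes "commuting_tuple T"
  shows "poly_calculus T (\<lambda>z. z $ i) (blinfun_apply (T $ i))"
proof -
  have "(\<Prod>j\<in>UNIV. (z $ j) ^ ((axis i 1 :: nat ^ 'b) $ j)) = z $ i" for z :: "complex ^ 'b"
    by (subst prod.remove[of _ i]) (auto simp: axis_def intro!: prod.neutral)
  then show ?thesis
    using poly_calculus_monom[of T 1 "axis i 1"]
    by (simp only: monom_op_axis[OF assms] scaleC_one mult_1_left)
qed

lemma poly_calculus_power:
  assumes "commuting_tuple T" "poly_calculus T f F"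
  shows "poly_calculus T (\<lambda>z. f z ^ n) (F ^^ n)"
proof (induction n)
  case (Suc n)
  show ?case
    unfolding power_Suc funpow.simps comp_def by (rule poly_calculus_comp[OF assms Suc.IH])
qed (simp add: id_def poly_calculus_one[OF assms(1)])

lemma poly_calculus_scale:
  assumes T: "commuting_tuple T" and f: "poly_calculus T f F"
  shows "poly_calculus T (\<lambda>z. c * f z) (\<lambda>x. c *\<^sub>C F x)"
proof -
  have "monom_op T 0 = id"
    by (simp add: monom_op_eq_partial partial_monom_op_trivial[OF T])
  then have "poly_calculus T (\<lambda>z. c) (\<lambda>x. c *\<^sub>C x)"
    using poly_calculus_monom[of T c 0] by simp
  from poly_calculus_comp[OF T this f] show ?thesis by (simp add: comp_def)
qed

text \<open>
  Substitution: if \<open>S = \<phi>(T)\<close>, then \<open>p(S) = (p \<circ> \<phi>)(T)\<close>. This is formal, since \<open>p(S)\<close> is built from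
  the \<open>S $ i\<close> by the same sums and products by which \<open>p(\<phi>(z))\<close> is built from the \<open>\<phi> z $ i\<close>.
\<close>

lemma poly_calculus_subst:
  assumes T: "commuting_tuple T" and S: "commuting_tuple S"
    and \<phi>: "\<And>i. poly_calculus T (\<lambda>z. \<phi> z $ i) (blinfun_apply (S $ i))"
  shows "poly_calculus T (\<lambda>z. poly_at p (\<phi> z)) (poly_op p S)"
proof -
  have "poly_calculus T (\<lambda>z. \<Prod>i\<in>I. (\<phi> z $ i) ^ (m $ i)) (partial_monom_op I S m)"
    if "finite I" for I m
    using that
  proof induction
    case (insert i I)
    show ?case
      unfolding prod.insert[OF insert.hyps] partial_monom_op_insert[OF S insert.hyps(2)] comp_def
      by (rule poly_calculus_comp[OF T poly_calculus_power[OF T \<phi>] insert.IH])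
  qed (simp add: partial_monom_op_empty poly_calculus_one[OF T] id_def)
  then have "poly_calculus T (\<lambda>z. \<Prod>i\<in>UNIV. (\<phi> z $ i) ^ (m $ i)) (monom_op S m)" for m
    by (simp add: monom_op_eq_partial)
  then show ?thesis
    unfolding poly_at_def poly_op_def by (intro poly_calculus_sum poly_calculus_scale[OF T])
qed

lemma continuous_on_poly_at: "continuous_on K (poly_at p)"
  unfolding poly_at_def by (intro continuous_intros)

text \<open>
  The transport principle. The supremum of an empty or unbounded set of reals is an unspecified value.
  That \<open>\<Omega>\<close> is nonempty and \<open>\<Omega>'\<close> bounded makes the supremum of \<open>\<bar>p \<circ> \<phi>\<bar>\<close> over \<open>closure \<Omega>\<close> comparable
  with that of \<open>\<bar>p\<bar>\<close> over the compact set \<open>closure \<Omega>'\<close>.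
\<close>

lemma domain_contraction_image:
  assumes T: "domain_contraction \<Omega> T" and ne: "\<Omega> \<noteq> {}" and S: "commuting_tuple S"
    and calc: "\<And>i. poly_calculus T (\<lambda>z. \<phi> z $ i) (blinfun_apply (S $ i))"
    and maps: "\<phi> ` \<Omega> \<subseteq> \<Omega>'" and bdd: "bounded \<Omega>'"
  shows "domain_contraction \<Omega>' S"
proof -
  have T': "commuting_tuple T" "spectral_set (closure \<Omega>) T"
    using T by (auto simp: domain_contraction_def)
  have "continuous_on (closure \<Omega>) (\<lambda>z. \<phi> z $ i)" for i
  proof -
    obtain q where "poly_at q = (\<lambda>z. \<phi> z $ i)"
      using calc[of i] by (auto simp: poly_calculus_def)
    then show ?thesis by (metis continuous_on_poly_at)
  qed
  then have "continuous_on (closure \<Omega>) (\<lambda>z. \<chi> i. \<phi> z $ i)"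
    by (rule continuous_on_vec_lambda)
  then have cont: "continuous_on (closure \<Omega>) \<phi>" by simp
  have maps': "\<phi> ` closure \<Omega> \<subseteq> closure \<Omega>'"
    by (rule image_closure_subset[OF cont]) (use maps closure_subset in auto)
  have "onorm (poly_op p S) \<le> (SUP w\<in>closure \<Omega>'. cmod (poly_at p w))" for p
  proof -
    obtain q where q: "poly_at q = (\<lambda>z. poly_at p (\<phi> z))" "poly_op q T = poly_op p S"
      using poly_calculus_subst[OF T'(1) S calc] by (auto simp: poly_calculus_def)
    have "compact ((\<lambda>w. cmod (poly_at p w)) ` closure \<Omega>')"
      using bdd by (intro compact_continuous_image continuous_on_norm continuous_on_poly_at) simp
    then have ba: "bdd_above ((\<lambda>w. cmod (poly_at p w)) ` closure \<Omega>')"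
      by (intro bounded_imp_bdd_above compact_imp_bounded)
    have "onorm (poly_op p S) \<le> (SUP z\<in>closure \<Omega>. cmod (poly_at q z))"
      using T'(2) by (simp add: spectral_set_def q(2)[symmetric])
    also have "\<dots> \<le> (SUP w\<in>closure \<Omega>'. cmod (poly_at p w))"
      using ne maps' by (intro cSUP_mono[OF _ ba]) (auto simp: q(1))
    finally show ?thesis .
  qed
  then show ?thesis using S by (simp add: domain_contraction_def spectral_set_def)
qed

section \<open>Vectors given by their coordinates\<close>


lemma vector_4:
  "(vector [a, b, c, d] :: 'a::zero ^ 4) $ 1 = a"
  "(vector [a, b, c, d] :: 'a ^ 4) $ 2 = b"
  "(vector [a, b, c, d] :: 'a ^ 4) $ 3 = c"
  "(vector [a, b, c, d] :: 'a ^ 4) $ 4 = d"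
  unfolding vector_def by simp_all

lemma vector_2_eq_iff:
  "(vector [a, b] :: 'a::zero ^ 2) = vector [a', b'] \<longleftrightarrow> a = a' \<and> b = b'"
  by (auto simp: vec_eq_iff forall_2)

lemma vector_3_eq_iff:
  "(vector [a, b, c] :: 'a::zero ^ 3) = vector [a', b', c'] \<longleftrightarrow> a = a' \<and> b = b' \<and> c = c'"
  by (auto simp: vec_eq_iff forall_3)

lemma vector_4_eq_iff:
  "(vector [a, b, c, d] :: 'a::zero ^ 4) = vector [a', b', c', d'] \<longleftrightarrow>
     a = a' \<and> b = b' \<and> c = c' \<and> d = d'"
  by (auto simp: vec_eq_iff forall_4 vector_4)

section \<open>The tetrablock and the symmetrized bidisc\<close>

lemma vector_in_tetrablock:
  "vector [x1, x2, x3] \<in> tetrablock \<longleftrightarrow>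
     (\<forall>z1 z2. cmod z1 \<le> 1 \<and> cmod z2 \<le> 1 \<longrightarrow> 1 - x1 * z1 - x2 * z2 + x3 * z1 * z2 \<noteq> 0)"
  by (simp add: tetrablock_def vector_3_eq_iff)

lemma vector_in_symmetrized_bidisc:
  "vector [s, p] \<in> symmetrized_bidisc \<longleftrightarrow>
     (\<exists>l1 l2. s = l1 + l2 \<and> p = l1 * l2 \<and> cmod l1 < 1 \<and> cmod l2 < 1)"
  by (auto simp: symmetrized_bidisc_def vector_2_eq_iff)

lemma reciprocal_in_closed_disc:
  assumes "\<not> cmod l < 1"
  shows "l \<noteq> 0" "cmod (1 / l) \<le> 1"
  using assms by (auto simp: norm_divide divide_le_eq_1)

text \<open>
  Factor \<open>1 - s z + p z\<^sup>2 = (1 - l1 z) (1 - l2 z)\<close>. A factor with \<open>\<bar>l\<bar> \<ge> 1\<close> would have its zero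
  \<open>1 / l\<close> in the closed disc.
\<close>

lemma vector_in_symmetrized_bidiscI:
  assumes "\<And>z. cmod z \<le> 1 \<Longrightarrow> 1 - s * z + p * z\<^sup>2 \<noteq> 0"
  shows "vector [s, p] \<in> symmetrized_bidisc"
proof -
  define r where "r = csqrt (s\<^sup>2 - 4 * p)"
  define l1 l2 where "l1 = (s + r) / 2" and "l2 = (s - r) / 2"
  have r: "r\<^sup>2 = s\<^sup>2 - 4 * p" by (simp add: r_def)
  have s: "s = l1 + l2" by (simp add: l1_def l2_def field_simps)
  have "(s + r) * (s - r) = s\<^sup>2 - r\<^sup>2"
    by (simp add: power2_eq_square algebra_simps)
  then have p: "p = l1 * l2" by (simp add: l1_def l2_def r)
  have lt1: "cmod a < 1" if ab: "s = a + b" "p = a * b" for a b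
  proof (rule ccontr)
    assume "\<not> cmod a < 1"
    note a = reciprocal_in_closed_disc[OF this]
    have "1 - s * (1 / a) + p * (1 / a)\<^sup>2 = 0"
      using a(1) by (simp add: ab power2_eq_square divide_simps)
    with assms[OF a(2)] show False by simp
  qed
  have "cmod l1 < 1" "cmod l2 < 1"
    using lt1[OF s p] lt1[of l2 l1] s p by (simp_all add: ac_simps)
  with s p show ?thesis by (auto simp: vector_in_symmetrized_bidisc)
qed

lemma tetrablock_diagonal:
  assumes "vector [x1, x2, x3] \<in> tetrablock"
  shows "vector [x1 + x2, x3] \<in> symmetrized_bidisc"
proof (rule vector_in_symmetrized_bidiscI)
  fix z :: complex
  assume "cmod z \<le> 1"
  then have "1 - x1 * z - x2 * z + x3 * z * z \<noteq> 0"
    using assms by (simp add: vector_in_tetrablock)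
  then show "1 - (x1 + x2) * z + x3 * z\<^sup>2 \<noteq> 0"
    by (simp add: power2_eq_square algebra_simps)
qed

text \<open>
  If one of the first two coordinates had modulus at least 1, the denominator would vanish at its
  reciprocal. The third coordinate is the product of the two points of the disc provided by
  \<open>tetrablock_diagonal\<close>.
\<close>

lemma tetrablock_coord_less_1:
  assumes "vector [x1, x2, x3] \<in> tetrablock"
  shows "cmod x1 < 1" "cmod x2 < 1" "cmod x3 < 1"
proof -
  have nz: "1 - x1 * z1 - x2 * z2 + x3 * z1 * z2 \<noteq> 0" if "cmod z1 \<le> 1" "cmod z2 \<le> 1" for z1 z2
    using assms that by (simp add: vector_in_tetrablock)
  show "cmod x1 < 1"
  proof (rule ccontr)
    assume "\<not> cmod x1 < 1"
    from reciprocal_in_closed_disc[OF this] show False using nz[of "1 / x1" 0] by simp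
  qed
  show "cmod x2 < 1"
  proof (rule ccontr)
    assume "\<not> cmod x2 < 1"
    from reciprocal_in_closed_disc[OF this] show False using nz[of 0 "1 / x2"] by simp
  qed
  obtain l1 l2 where l: "x3 = l1 * l2" "cmod l1 < 1" "cmod l2 < 1"
    using tetrablock_diagonal[OF assms] by (auto simp: vector_in_symmetrized_bidisc)
  then show "cmod x3 < 1"
    using mult_strict_mono[of "cmod l1" 1 "cmod l2" 1] by (simp add: norm_mult)
qed

lemma bounded_vec_if_components:
  fixes S :: "(complex ^ 'n::finite) set"
  assumes "\<And>v i. v \<in> S \<Longrightarrow> cmod (v $ i) \<le> b"
  shows "bounded S"
proof (rule boundedI)
  fix v assume "v \<in> S"
  then have "(\<Sum>i\<in>UNIV. cmod (v $ i)) \<le> (\<Sum>i\<in>(UNIV::'n set). b)"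
    by (intro sum_mono assms)
  then show "norm v \<le> (\<Sum>i\<in>(UNIV::'n set). b)"
    unfolding norm_vec_def by (rule order_trans[OF L2_set_le_sum[OF norm_ge_zero]])
qed

lemma bounded_tetrablock: "bounded tetrablock"
proof (rule bounded_vec_if_components)
  fix v and i :: 3
  assume v: "v \<in> tetrablock"
  then obtain x1 x2 x3 where x: "v = vector [x1, x2, x3]" by (auto simp: tetrablock_def)
  have "\<forall>i. cmod (v $ i) \<le> 1"
    using tetrablock_coord_less_1[OF v[unfolded x]] by (simp add: x forall_3)
  then show "cmod (v $ i) \<le> 1" by blast
qed

section \<open>The hexablock and the pentablock\<close>

text \<open>
  The tetrablock condition excludes zeros of the denominator on the closed bidisc, so that the
  functional is continuous on a compact set. Only with this bound can the values of the functional be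
  estimated by its supremum.
\<close>

lemma bdd_above_hexablock_functional:
  assumes "vector [x1, x2, x3] \<in> tetrablock"
  shows "bdd_above ((\<lambda>(z1, z2). cmod (a * complex_of_real (sqrt ((1 - (cmod z1)\<^sup>2) * (1 - (cmod z2)\<^sup>2)))
              / (1 - x1 * z1 - x2 * z2 + x3 * z1 * z2))) ` (unit_disc \<times> unit_disc))"
    (is "bdd_above (?f ` _)")
proof -
  have "continuous_on (cball 0 1 \<times> cball 0 1) ?f"
    unfolding case_prod_beta using assms
    by (intro continuous_intros) (auto simp: vector_in_tetrablock)
  then have "compact (?f ` (cball 0 1 \<times> cball 0 1))"
    by (intro compact_continuous_image compact_Times compact_cball)
  then have "bdd_above (?f ` (cball 0 1 \<times> cball 0 1))"
    by (intro bounded_imp_bdd_above compact_imp_bounded)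
  then show ?thesis
    by (rule bdd_above_mono) (intro image_mono Sigma_mono ball_subset_cball)
qed

lemma vector_in_hexablock:
  "vector [a, x1, x2, x3] \<in> hexablock \<longleftrightarrow>
     vector [x1, x2, x3] \<in> tetrablock \<and>
     (SUP (z1, z2)\<in>unit_disc \<times> unit_disc.
        cmod (a * complex_of_real (sqrt ((1 - (cmod z1)\<^sup>2) * (1 - (cmod z2)\<^sup>2)))
              / (1 - x1 * z1 - x2 * z2 + x3 * z1 * z2))) < 1"
  by (simp add: hexablock_def vector_4_eq_iff)

lemma hexablock_functional_less_1:
  assumes "vector [a, x1, x2, x3] \<in> hexablock" "cmod z1 < 1" "cmod z2 < 1"
  shows "cmod (a * complex_of_real (sqrt ((1 - (cmod z1)\<^sup>2) * (1 - (cmod z2)\<^sup>2)))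
              / (1 - x1 * z1 - x2 * z2 + x3 * z1 * z2)) < 1"
proof -
  have H: "vector [x1, x2, x3] \<in> tetrablock"
    "(SUP (z1, z2)\<in>unit_disc \<times> unit_disc.
        cmod (a * complex_of_real (sqrt ((1 - (cmod z1)\<^sup>2) * (1 - (cmod z2)\<^sup>2)))
              / (1 - x1 * z1 - x2 * z2 + x3 * z1 * z2))) < 1"
    using assms(1) by (auto simp: vector_in_hexablock)
  have "(z1, z2) \<in> unit_disc \<times> unit_disc" using assms by simp
  from cSUP_upper[OF this bdd_above_hexablock_functional[OF H(1), of a]] H(2)
  show ?thesis by simp
qed

text \<open>
  The hypothesis is the hexablock functional at \<open>z1 = cnj x\<close>, \<open>z2 = 0\<close>. At this point the
  denominator \<open>1 - x * cnj x\<close> is the square of the numerator's root, and the quotient is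
  \<open>\<bar>a\<bar> / sqrt (1 - \<bar>x\<bar>\<^sup>2)\<close>.
\<close>

lemma norm_sq_sum_less_1:
  assumes x: "cmod x < 1"
    and le: "cmod (a * complex_of_real (sqrt (1 - (cmod x)\<^sup>2)) / (1 - x * cnj x)) < 1"
  shows "(cmod a)\<^sup>2 + (cmod x)\<^sup>2 < 1"
proof -
  define t where "t = 1 - (cmod x)\<^sup>2"
  have t: "t > 0" using x by (simp add: t_def power_less_one_iff)
  have "1 - x * cnj x = complex_of_real t"
    by (simp add: t_def complex_norm_square[symmetric] del: of_real_power)
  with le have "cmod a * sqrt t / t < 1"
    using t by (simp add: t_def[symmetric] norm_mult norm_divide)
  then have "cmod a * sqrt t < t"
    using t by (simp add: field_simps)
  then have "cmod a * sqrt t < sqrt t * sqrt t" using t by simp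
  then have "cmod a < sqrt t" using t by (subst (asm) mult_less_cancel_right) simp
  then have "(cmod a)\<^sup>2 < (sqrt t)\<^sup>2" by (intro power_strict_mono) auto
  then show ?thesis using t by (simp add: t_def)
qed

lemma vector_in_euclidean_ball2:
  "vector [a, x] \<in> euclidean_ball2 \<longleftrightarrow> (cmod a)\<^sup>2 + (cmod x)\<^sup>2 < 1"
  by (simp add: euclidean_ball2_def norm_vec_def L2_set_def sum_2)

lemma hexablock_to_ball:
  assumes "vector [a, x1, x2, x3] \<in> hexablock"
  shows "vector [a, x1] \<in> euclidean_ball2" "vector [a, x2] \<in> euclidean_ball2"
proof -
  have "vector [x1, x2, x3] \<in> tetrablock" using assms by (simp add: vector_in_hexablock)
  note x = tetrablock_coord_less_1[OF this]
  have "(cmod a)\<^sup>2 + (cmod x1)\<^sup>2 < 1"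
    by (rule norm_sq_sum_less_1[OF x(1)])
      (use hexablock_functional_less_1[OF assms, of "cnj x1" 0] x in simp)
  moreover have "(cmod a)\<^sup>2 + (cmod x2)\<^sup>2 < 1"
    by (rule norm_sq_sum_less_1[OF x(2)])
      (use hexablock_functional_less_1[OF assms, of 0 "cnj x2"] x in simp)
  ultimately show "vector [a, x1] \<in> euclidean_ball2" "vector [a, x2] \<in> euclidean_ball2"
    by (simp_all add: vector_in_euclidean_ball2)
qed

lemma vector_in_pentablock:
  "vector [a, s, p] \<in> pentablock \<longleftrightarrow>
     vector [s, p] \<in> symmetrized_bidisc \<and>
     (SUP z\<in>unit_disc. cmod (a * complex_of_real (1 - (cmod z)\<^sup>2) / (1 - s * z + p * z\<^sup>2))) < 1"
  by (simp add: pentablock_def vector_3_eq_iff)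

text \<open>
  On the diagonal the product under the root is a perfect square and the hexablock functional becomes
  the pentablock functional; a supremum over the diagonal is at most the supremum over the bidisc.
\<close>

lemma hexablock_to_pentablock:
  assumes "vector [a, x1, x2, x3] \<in> hexablock"
  shows "vector [a, x1 + x2, x3] \<in> pentablock"
proof -
  have H: "vector [x1, x2, x3] \<in> tetrablock"
    "(SUP (z1, z2)\<in>unit_disc \<times> unit_disc.
        cmod (a * complex_of_real (sqrt ((1 - (cmod z1)\<^sup>2) * (1 - (cmod z2)\<^sup>2)))
              / (1 - x1 * z1 - x2 * z2 + x3 * z1 * z2))) < 1"
    using assms by (auto simp: vector_in_hexablock)
  have "(SUP z\<in>unit_disc. cmod (a * complex_of_real (1 - (cmod z)\<^sup>2) / (1 - (x1 + x2) * z + x3 * z\<^sup>2)))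
      \<le> (SUP (z1, z2)\<in>unit_disc \<times> unit_disc.
        cmod (a * complex_of_real (sqrt ((1 - (cmod z1)\<^sup>2) * (1 - (cmod z2)\<^sup>2)))
              / (1 - x1 * z1 - x2 * z2 + x3 * z1 * z2)))"
  proof (rule cSUP_mono[OF _ bdd_above_hexablock_functional[OF H(1)]])
    fix z :: complex
    assume z: "z \<in> unit_disc"
    then have "(cmod z)\<^sup>2 \<le> 1" by (simp add: power_le_one)
    then have "sqrt ((1 - (cmod z)\<^sup>2) * (1 - (cmod z)\<^sup>2)) = 1 - (cmod z)\<^sup>2"
      by simp
    moreover have "1 - x1 * z - x2 * z + x3 * z * z = 1 - (x1 + x2) * z + x3 * z\<^sup>2"
      by (simp add: power2_eq_square algebra_simps)
    ultimately show "\<exists>w\<in>unit_disc \<times> unit_disc.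
        cmod (a * complex_of_real (1 - (cmod z)\<^sup>2) / (1 - (x1 + x2) * z + x3 * z\<^sup>2)) \<le>
        (case w of (z1, z2) \<Rightarrow>
        cmod (a * complex_of_real (sqrt ((1 - (cmod z1)\<^sup>2) * (1 - (cmod z2)\<^sup>2)))
              / (1 - x1 * z1 - x2 * z2 + x3 * z1 * z2)))"
      using z by (intro bexI[of _ "(z, z)"]) (simp_all only: split_conv order_refl mem_Sigma_iff simp_thms)
  qed simp
  with H(2) have "(SUP z\<in>unit_disc. cmod (a * complex_of_real (1 - (cmod z)\<^sup>2) / (1 - (x1 + x2) * z + x3 * z\<^sup>2))) < 1"
    by simp
  then show ?thesis
    using tetrablock_diagonal[OF H(1)] by (simp add: vector_in_pentablock)
qed

text \<open>
  The value of the pentablock functional at \<open>z = 0\<close> is \<open>\<bar>a\<bar>\<close>. As for the hexablock, the functional has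
  to be bounded before this value can be compared with the supremum; here the denominator is
  \<open>(1 - l1 z) (1 - l2 z)\<close> with \<open>\<bar>l1\<bar>, \<bar>l2\<bar> < 1\<close>. The common bound 2 comes from \<open>s = l1 + l2\<close>.
\<close>

lemma pentablock_coord_bounds:
  assumes "vector [a, s, p] \<in> pentablock"
  shows "cmod a \<le> 2" "cmod s \<le> 2" "cmod p \<le> 2"
proof -
  let ?g = "\<lambda>z. cmod (a * complex_of_real (1 - (cmod z)\<^sup>2) / (1 - s * z + p * z\<^sup>2))"
  have P: "vector [s, p] \<in> symmetrized_bidisc" "(SUP z\<in>unit_disc. ?g z) < 1"
    using assms by (auto simp: vector_in_pentablock)
  obtain l1 l2 where l: "s = l1 + l2" "p = l1 * l2" "cmod l1 < 1" "cmod l2 < 1"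
    using P(1) by (auto simp: vector_in_symmetrized_bidisc)
  show "cmod s \<le> 2" using norm_triangle_ineq[of l1 l2] l by simp
  show "cmod p \<le> 2"
    using mult_mono[of "cmod l1" 1 "cmod l2" 1] l by (simp add: norm_mult)
  have nz: "1 - s * z + p * z\<^sup>2 \<noteq> 0" if "cmod z \<le> 1" for z
  proof -
    have "l * z \<noteq> 1" if "cmod l < 1" for l
      using mult_le_one[of "cmod l" "cmod z"] mult_left_le[of "cmod z" "cmod l"] that \<open>cmod z \<le> 1\<close>
      by (metis norm_ge_zero norm_mult norm_one order_le_less_trans order_less_irrefl)
    then have "(1 - l1 * z) * (1 - l2 * z) \<noteq> 0" using l(3,4) by simp
    then show ?thesis by (simp add: l power2_eq_square algebra_simps)
  qed
  have "continuous_on (cball 0 1) ?g"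
    by (intro continuous_intros) (simp add: nz)
  then have "compact (?g ` cball 0 1)"
    by (intro compact_continuous_image compact_cball)
  then have "bdd_above (?g ` cball 0 1)"
    by (intro bounded_imp_bdd_above compact_imp_bounded)
  then have "bdd_above (?g ` unit_disc)"
    by (rule bdd_above_mono) (intro image_mono ball_subset_cball)
  from cSUP_upper[OF _ this, of 0] P(2) show "cmod a \<le> 2" by simp
qed

lemma bounded_pentablock: "bounded pentablock"
proof (rule bounded_vec_if_components)
  fix v and i :: 3
  assume v: "v \<in> pentablock"
  then obtain a s p where x: "v = vector [a, s, p]" by (auto simp: pentablock_def)
  have "\<forall>i. cmod (v $ i) \<le> 2"
    using pentablock_coord_bounds[OF v[unfolded x]] by (simp add: x forall_3)
  then show "cmod (v $ i) \<le> 2" by blast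
qed

lemma hexablock_nonempty: "hexablock \<noteq> {}"
proof -
  have "vector [0, 0, 0, 0] \<in> hexablock"
    by (simp add: vector_in_hexablock vector_in_tetrablock case_prod_beta)
  then show ?thesis by blast
qed

section \<open>The operators attached to a hexablock contraction\<close>

theorem theorem2p7:
  fixes A X1 X2 X3 :: "'a::chilbert_space \<Rightarrow>\<^sub>L 'a"
  assumes "domain_contraction hexablock (vector [A, X1, X2, X3])"
  shows "(domain_contraction euclidean_ball2 (vector [A, X1]) \<and>
          domain_contraction euclidean_ball2 (vector [A, X2])) \<and>
         domain_contraction tetrablock (vector [X1, X2, X3]) \<and>
         domain_contraction pentablock (vector [A, X1 + X2, X3])"
proof -
  let ?T = "vector [A, X1, X2, X3] :: ('a \<Rightarrow>\<^sub>L 'a) ^ 4"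
  have T: "commuting_tuple ?T" using assms by (simp add: domain_contraction_def)
  have linear: "complex_linear_op A" "complex_linear_op X1" "complex_linear_op X2" "complex_linear_op X3"
    and commute: "A o\<^sub>L X1 = X1 o\<^sub>L A" "A o\<^sub>L X2 = X2 o\<^sub>L A" "A o\<^sub>L X3 = X3 o\<^sub>L A"
      "X1 o\<^sub>L X2 = X2 o\<^sub>L X1" "X1 o\<^sub>L X3 = X3 o\<^sub>L X1" "X2 o\<^sub>L X3 = X3 o\<^sub>L X2"
    using T unfolding commuting_tuple_def forall_4 vector_4 by blast+
  have linear_sum: "complex_linear_op (X1 + X2)"
    using linear by (simp add: complex_linear_op_def blinfun.add_left scaleC_add_right)
  have commute_sum: "A o\<^sub>L (X1 + X2) = (X1 + X2) o\<^sub>L A" "X3 o\<^sub>L (X1 + X2) = (X1 + X2) o\<^sub>L X3"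
    by (simp_all only: commute bounded_bilinear.add_left[OF bounded_bilinear_blinfun_compose]
        bounded_bilinear.add_right[OF bounded_bilinear_blinfun_compose])
  note coord = poly_calculus_coord[OF T, of 1, unfolded vector_4]
    poly_calculus_coord[OF T, of 2, unfolded vector_4]
    poly_calculus_coord[OF T, of 3, unfolded vector_4]
    poly_calculus_coord[OF T, of 4, unfolded vector_4]
  have coord_sum: "poly_calculus ?T (\<lambda>z. z $ 2 + z $ 3) (blinfun_apply (X1 + X2))"
    using poly_calculus_add[OF coord(2,3)] by (simp only: plus_blinfun.rep_eq)
  have hexablock_coords: "\<exists>a x1 x2 x3. v = vector [a, x1, x2, x3]" if "v \<in> hexablock" for v
    using that unfolding hexablock_def by blast
  have "domain_contraction euclidean_ball2 (vector [A, X1])"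
  proof (rule domain_contraction_image[OF assms hexablock_nonempty])
    let ?\<phi> = "\<lambda>z :: complex ^ 4. vector [z $ 1, z $ 2] :: complex ^ 2"
    show "commuting_tuple (vector [A, X1] :: ('a \<Rightarrow>\<^sub>L 'a) ^ 2)"
      unfolding commuting_tuple_def forall_2 vector_2 by (simp add: linear commute)
    have "\<forall>i. poly_calculus ?T (\<lambda>z. ?\<phi> z $ i) (blinfun_apply (vector [A, X1] $ i))"
      unfolding forall_2 vector_2 by (simp add: coord)
    then show "poly_calculus ?T (\<lambda>z. ?\<phi> z $ i) (blinfun_apply (vector [A, X1] $ i))" for i
      by blast
    show "?\<phi> ` hexablock \<subseteq> euclidean_ball2"
      using hexablock_to_ball(1) hexablock_coords by (fastforce simp: vector_4)
  qed (simp add: euclidean_ball2_def)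
  moreover have "domain_contraction euclidean_ball2 (vector [A, X2])"
  proof (rule domain_contraction_image[OF assms hexablock_nonempty])
    let ?\<phi> = "\<lambda>z :: complex ^ 4. vector [z $ 1, z $ 3] :: complex ^ 2"
    show "commuting_tuple (vector [A, X2] :: ('a \<Rightarrow>\<^sub>L 'a) ^ 2)"
      unfolding commuting_tuple_def forall_2 vector_2 by (simp add: linear commute)
    have "\<forall>i. poly_calculus ?T (\<lambda>z. ?\<phi> z $ i) (blinfun_apply (vector [A, X2] $ i))"
      unfolding forall_2 vector_2 by (simp add: coord)
    then show "poly_calculus ?T (\<lambda>z. ?\<phi> z $ i) (blinfun_apply (vector [A, X2] $ i))" for i
      by blast
    show "?\<phi> ` hexablock \<subseteq> euclidean_ball2"
      using hexablock_to_ball(2) hexablock_coords by (fastforce simp: vector_4)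
  qed (simp add: euclidean_ball2_def)
  moreover have "domain_contraction tetrablock (vector [X1, X2, X3])"
  proof (rule domain_contraction_image[OF assms hexablock_nonempty _ _ _ bounded_tetrablock])
    let ?\<phi> = "\<lambda>z :: complex ^ 4. vector [z $ 2, z $ 3, z $ 4] :: complex ^ 3"
    show "commuting_tuple (vector [X1, X2, X3] :: ('a \<Rightarrow>\<^sub>L 'a) ^ 3)"
      unfolding commuting_tuple_def forall_3 vector_3 by (simp add: linear commute)
    have "\<forall>i. poly_calculus ?T (\<lambda>z. ?\<phi> z $ i) (blinfun_apply (vector [X1, X2, X3] $ i))"
      unfolding forall_3 vector_3 by (simp add: coord)
    then show "poly_calculus ?T (\<lambda>z. ?\<phi> z $ i) (blinfun_apply (vector [X1, X2, X3] $ i))" for i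
      by blast
    show "?\<phi> ` hexablock \<subseteq> tetrablock"
      using hexablock_coords by (fastforce simp: vector_4 vector_in_hexablock)
  qed
  moreover have "domain_contraction pentablock (vector [A, X1 + X2, X3])"
  proof (rule domain_contraction_image[OF assms hexablock_nonempty _ _ _ bounded_pentablock])
    let ?\<phi> = "\<lambda>z :: complex ^ 4. vector [z $ 1, z $ 2 + z $ 3, z $ 4] :: complex ^ 3"
    show "commuting_tuple (vector [A, X1 + X2, X3] :: ('a \<Rightarrow>\<^sub>L 'a) ^ 3)"
      unfolding commuting_tuple_def forall_3 vector_3
      by (simp add: linear linear_sum commute commute_sum)
    have "\<forall>i. poly_calculus ?T (\<lambda>z. ?\<phi> z $ i) (blinfun_apply (vector [A, X1 + X2, X3] $ i))"
      unfolding forall_3 vector_3 by (simp add: coord coord_sum)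
    then show "poly_calculus ?T (\<lambda>z. ?\<phi> z $ i) (blinfun_apply (vector [A, X1 + X2, X3] $ i))" for i
      by blast
    show "?\<phi> ` hexablock \<subseteq> pentablock"
      using hexablock_to_pentablock hexablock_coords by (fastforce simp: vector_4)
  qed
  ultimately show ?thesis by blast
qed

end
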